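(* Let $G$ be a discrete group and $\sigma:G\to\mathbb{C}^\times$ a group homomorphism. The cosimplicial module $\{M^n(C_0(G)),\delta_i,\sigma_j\}_{n\ge0}$, together with the operators $\tau_n$, is a cocyclic module, and the coboundary $b=\sum_{i=0}^{n+1}(-1)^i\delta_i$ restricts to the cyclic cochains: if $x\in M^n(C_0(G))$ satisfies $(-1)^n\tau_n(x)=x$, then $(-1)^{n+1}\tau_{n+1}(bx)=bx$.
   Context: $C_0(G)$ is the algebra of finitely supported functions $G\to\mathbb{C}$, and $M^n(C_0(G))$, the multiplier algebra of $C_0(G)^{\otimes n}$, is identified with the space of all functions $G^n\to\mathbb{C}$; $M^0=\mathbb{C}$. Let $e$ be the neutral element. Coface maps $\delta_i:M^n(C_0(G))\to M^{n+1}(C_0(G))$, $0\le i\le n+1$: $\delta_0F(g_1,\dots,g_{n+1})=F(g_2,\dots,g_{n+1})$; $\delta_iF(g_1,\dots,g_{n+1})=F(g_1,\dots,g_ig_{i+1},\dots,g_{n+1})$ for $1\le i\le n$; $\delta_{n+1}F(g_1,\dots,g_{n+1})=F(g_1,\dots,g_n)\sigma(g_{n+1})$. Codegeneracy maps $\sigma_j:M^{n+1}(C_0(G))\to M^n(C_0(G))$, $0\le j\le n$: $\sigma_jF(g_1,\dots,g_n)=F(g_1,\dots,g_j,e,g_{j+1},\dots,g_n)$. Cyclicity operators (with the character $\delta$ of the modular pair equal to the counit): $\tau_0=\mathrm{id}$ and, for $n\ge1$, $\tau_n(F)(g_1,\dots,g_n)=F((g_1\cdots g_n)^{-1},g_1,\dots,g_{n-1})\sigma(g_n)$.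 A cocyclic module is a cosimplicial module with operators $\tau_n$ in each degree $n$ satisfying $\tau_{n+1}\delta_p=\delta_{p-1}\tau_n$ ($1\le p\le n+1$), $\tau_{n+1}\delta_0=\delta_{n+1}$, $\tau_n\sigma_p=\sigma_{p-1}\tau_{n+1}$ ($1\le p\le n$), $\tau_n\sigma_0=\sigma_n\tau_{n+1}^2$ and $\tau_n^{n+1}=\mathrm{id}$. *)

theory Defs
  imports
    Complex_Main
    "HOL-Algebra.Module"
    "HOL-Algebra.Multiplicative_Group"
    "HOL-Algebra.Algebraic_Closure_Type"
    "HOL-Library.NList"
begin

section \<open>Cosimplicial and cocyclic modules\<close>

definition linear_maps ::
  "('r, 'm) ring_scheme \<Rightarrow> ('r, 'a, 'k) module_scheme \<Rightarrow> ('r, 'b, 'l) module_scheme \<Rightarrow> ('a \<Rightarrow> 'b) set"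
  where "linear_maps R M N =
    {f \<in> carrier M \<rightarrow> carrier N.
       (\<forall>x\<in>carrier M. \<forall>y\<in>carrier M. f (x \<oplus>\<^bsub>M\<^esub> y) = f x \<oplus>\<^bsub>N\<^esub> f y) \<and>
       (\<forall>a\<in>carrier R. \<forall>x\<in>carrier M. f (a \<odot>\<^bsub>M\<^esub> x) = a \<odot>\<^bsub>N\<^esub> f x)}"

text \<open>
  The first argument of \<open>d\<close>, \<open>s\<close> and \<open>t\<close> is the degree \<open>n\<close>: the operators are
  \<open>d n i : M n \<rightarrow> M (n+1)\<close>, \<open>s n j : M (n+1) \<rightarrow> M n\<close> and \<open>t n : M n \<rightarrow> M n\<close>.
\<close>

locale cosimplicial_module =
  fixes R :: "('r, 'm) ring_scheme"
    and M :: "nat \<Rightarrow> ('r, 'a, 'k) module_scheme"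
    and d :: "nat \<Rightarrow> nat \<Rightarrow> 'a \<Rightarrow> 'a"
    and s :: "nat \<Rightarrow> nat \<Rightarrow> 'a \<Rightarrow> 'a"
  assumes module: "module R (M n)"
    and coface_linear: "i \<le> Suc n \<Longrightarrow> d n i \<in> linear_maps R (M n) (M (Suc n))"
    and codegeneracy_linear: "j \<le> n \<Longrightarrow> s n j \<in> linear_maps R (M (Suc n)) (M n)"
    and coface_coface:
      "\<lbrakk>i < j; j \<le> n + 2; x \<in> carrier (M n)\<rbrakk>
         \<Longrightarrow> d (Suc n) j (d n i x) = d (Suc n) i (d n (j - 1) x)"
    and codegeneracy_codegeneracy:
      "\<lbrakk>i \<le> j; j \<le> n; x \<in> carrier (M (n + 2))\<rbrakk>
         \<Longrightarrow> s n j (s (Suc n) i x) = s n i (s (Suc n) (j + 1) x)"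
    and codegeneracy_coface_less:
      "\<lbrakk>i < j; j \<le> Suc n; x \<in> carrier (M (Suc n))\<rbrakk>
         \<Longrightarrow> s (Suc n) j (d (Suc n) i x) = d n i (s n (j - 1) x)"
    and codegeneracy_coface_id:
      "\<lbrakk>i = j \<or> i = j + 1; j \<le> n; x \<in> carrier (M n)\<rbrakk>
         \<Longrightarrow> s n j (d n i x) = x"
    and codegeneracy_coface_greater:
      "\<lbrakk>j + 1 < i; i \<le> n + 2; x \<in> carrier (M (Suc n))\<rbrakk>
         \<Longrightarrow> s (Suc n) j (d (Suc n) i x) = d n (i - 1) (s n j x)"

locale cocyclic_module = cosimplicial_module R M d s
  for R :: "('r, 'm) ring_scheme"
    and M :: "nat \<Rightarrow> ('r, 'a, 'k) module_scheme"
    and d :: "nat \<Rightarrow> nat \<Rightarrow> 'a \<Rightarrow> 'a"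
    and s :: "nat \<Rightarrow> nat \<Rightarrow> 'a \<Rightarrow> 'a" +
  fixes t :: "nat \<Rightarrow> 'a \<Rightarrow> 'a"
  assumes cyclic_linear: "t n \<in> linear_maps R (M n) (M n)"
    and cyclic_coface:
      "\<lbrakk>1 \<le> p; p \<le> n + 1; x \<in> carrier (M n)\<rbrakk>
         \<Longrightarrow> t (n + 1) (d n p x) = d n (p - 1) (t n x)"
    and cyclic_coface_zero:
      "x \<in> carrier (M n) \<Longrightarrow> t (n + 1) (d n 0 x) = d n (n + 1) x"
    and cyclic_codegeneracy:
      "\<lbrakk>1 \<le> p; p \<le> n; x \<in> carrier (M (n + 1))\<rbrakk>
         \<Longrightarrow> t n (s n p x) = s n (p - 1) (t (n + 1) x)"
    and cyclic_codegeneracy_zero: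
      "x \<in> carrier (M (n + 1)) \<Longrightarrow> t n (s n 0 x) = s n n ((t (n + 1) ^^ 2) x)"
    and cyclic_power: "x \<in> carrier (M n) \<Longrightarrow> (t n ^^ (n + 1)) x = x"

section \<open>Functions on powers of a group\<close>

abbreviation complex_field :: "complex ring" ("\<C>")
  where "\<C> \<equiv> ring_of_type_algebra"

text \<open>
  \<open>mult_functions G n\<close> is the space of all functions from the \<open>n\<close>-fold power of \<open>G\<close>, encoded as
  lists of length \<open>n\<close>, to the complex numbers, with pointwise operations. It stands for the
  multiplier algebra of the \<open>n\<close>-fold tensor power of the finitely supported functions on \<open>G\<close>.
  Functions are extensional: they take the value \<open>undefined\<close> off their domain, which makes
  equality of elements the same as agreement on the domain. In degree \<open>0\<close> the
  domain is \<open>{[]}\<close>, so a function amounts to a single complex number.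
\<close>

definition mult_functions ::
  "('g, 'z) monoid_scheme \<Rightarrow> nat \<Rightarrow> (complex, 'g list \<Rightarrow> complex) module"
  where "mult_functions G n =
    \<lparr>carrier = nlists n (carrier G) \<rightarrow>\<^sub>E UNIV,
     monoid.mult = (\<lambda>F H. \<lambda>g\<in>nlists n (carrier G). F g * H g),
     one = (\<lambda>g\<in>nlists n (carrier G). 1),
     ring.zero = (\<lambda>g\<in>nlists n (carrier G). 0),
     add = (\<lambda>F H. \<lambda>g\<in>nlists n (carrier G). F g + H g),
     module.smult = (\<lambda>c F. \<lambda>g\<in>nlists n (carrier G). c * F g)\<rparr>"

text \<open>
  Lists are indexed from \<open>0\<close>, so the \<open>i\<close>-th coordinate of a tuple \<open>g\<close> is \<open>g ! (i - 1)\<close>.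
\<close>

definition coface ::
  "('g, 'z) monoid_scheme \<Rightarrow> ('g \<Rightarrow> complex) \<Rightarrow> nat \<Rightarrow> nat \<Rightarrow> ('g list \<Rightarrow> complex) \<Rightarrow> 'g list \<Rightarrow> complex"
  where "coface G \<sigma> n i F =
    (\<lambda>g\<in>nlists (n + 1) (carrier G).
       if i = 0 then F (tl g)
       else if i \<le> n then F (take (i - 1) g @ [g ! (i - 1) \<otimes>\<^bsub>G\<^esub> g ! i] @ drop (i + 1) g)
       else F (butlast g) * \<sigma> (last g))"

definition codegeneracy ::
  "('g, 'z) monoid_scheme \<Rightarrow> nat \<Rightarrow> nat \<Rightarrow> ('g list \<Rightarrow> complex) \<Rightarrow> 'g list \<Rightarrow> complex"
  where "codegeneracy G n j F =
    (\<lambda>g\<in>nlists n (carrier G). F (take j g @ [\<one>\<^bsub>G\<^esub>] @ drop j g))"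

definition cyclicity ::
  "('g, 'z) monoid_scheme \<Rightarrow> ('g \<Rightarrow> complex) \<Rightarrow> nat \<Rightarrow> ('g list \<Rightarrow> complex) \<Rightarrow> 'g list \<Rightarrow> complex"
  where "cyclicity G \<sigma> n F =
    (if n = 0 then F
     else (\<lambda>g\<in>nlists n (carrier G).
             F (inv\<^bsub>G\<^esub> (foldr (\<otimes>\<^bsub>G\<^esub>) g \<one>\<^bsub>G\<^esub>) # butlast g) * \<sigma> (last g)))"

definition coboundary ::
  "('g, 'z) monoid_scheme \<Rightarrow> ('g \<Rightarrow> complex) \<Rightarrow> nat \<Rightarrow> ('g list \<Rightarrow> complex) \<Rightarrow> 'g list \<Rightarrow> complex"
  where "coboundary G \<sigma> n F =
    (\<Oplus>\<^bsub>mult_functions G (n + 1)\<^esub> i\<in>{0..n + 1}.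
       (-1) ^ i \<odot>\<^bsub>mult_functions G (n + 1)\<^esub> coface G \<sigma> n i F)"

end

theory Submission
  imports Defs
begin

text \<open>
  Every operator is composition with a map between powers of \<open>G\<close>, followed by multiplication with a
  value of \<open>\<sigma>\<close>, so each cosimplicial or cyclic identity reduces to one between maps of tuples and one
  between values of \<open>\<sigma>\<close>. For the order of the cyclicity operator, put \<open>g\<^sub>0 = (g\<^sub>1 \<dots> g\<^sub>n)\<^sup>-\<^sup>1\<close>: the operator
  cyclically rotates the tuples \<open>(g\<^sub>0, \<dots>, g\<^sub>n)\<close> with product \<open>\<one>\<close>, and after \<open>n + 1\<close> rotations the
  collected weight is \<open>\<sigma> (g\<^sub>0 \<dots> g\<^sub>n) = 1\<close>. On a cyclic cochain the identities
  \<open>\<tau> \<delta>\<^sub>i = \<delta>\<^sub>i\<^sub>-\<^sub>1 \<tau>\<close> and \<open>\<tau> \<delta>\<^sub>0 = \<delta>\<^sub>n\<^sub>+\<^sub>1\<close> shift the terms of the alternating sum by one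
  place, which gives the invariance of the coboundary.
\<close>

section \<open>Linear maps and the modules of functions on tuples\<close>

lemma nth_ext:
  assumes "length xs = n" "length ys = n" "\<And>k. k < n \<Longrightarrow> xs ! k = ys ! k"
  shows "xs = ys"
  using assms by (auto intro: nth_equalityI)

lemma linear_maps_closed:
  "f \<in> linear_maps R M N \<Longrightarrow> x \<in> carrier M \<Longrightarrow> f x \<in> carrier N"
  by (auto simp: linear_maps_def)

text \<open>A formula for an operator may hold only on the carrier. Linearity still transfers, since
  the carrier of a module is closed under sums and scalar multiples, so both maps agree at every
  argument involved.\<close>

lemma linear_maps_cong:
  assumes "f \<in> linear_maps R M N" "\<And>x. x \<in> carrier M \<Longrightarrow> g x = f x"
    "module R M"
  shows "g \<in> linear_maps R M N"
proof -
  interpret module R M by (rule assms(3))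
  show ?thesis using assms(1,2) by (auto simp: linear_maps_def Pi_def)
qed

lemma mult_functions_sel:
  "carrier (mult_functions G n) = nlists n (carrier G) \<rightarrow>\<^sub>E UNIV"
  "F \<oplus>\<^bsub>mult_functions G n\<^esub> H = (\<lambda>g\<in>nlists n (carrier G). F g + H g)"
  "\<zero>\<^bsub>mult_functions G n\<^esub> = (\<lambda>g\<in>nlists n (carrier G). 0)"
  "c \<odot>\<^bsub>mult_functions G n\<^esub> F = (\<lambda>g\<in>nlists n (carrier G). c * F g)"
  by (simp_all add: mult_functions_def)

lemma complex_field_sel:
  "carrier \<C> = UNIV" "a \<oplus>\<^bsub>\<C>\<^esub> b = a + b" "a \<otimes>\<^bsub>\<C>\<^esub> b = a * b"
  "\<one>\<^bsub>\<C>\<^esub> = 1" "\<zero>\<^bsub>\<C>\<^esub> = 0"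
  by (simp_all add: ring_of_type_algebra_def)

lemma mult_functions_eqI:
  assumes "F \<in> carrier (mult_functions G n)" "H \<in> carrier (mult_functions G n)"
    and "\<And>g. g \<in> nlists n (carrier G) \<Longrightarrow> F g = H g"
  shows "F = H"
  using assms unfolding mult_functions_sel by (rule PiE_ext)

lemma module_mult_functions: "module \<C> (mult_functions G n)"
proof (rule moduleI)
  show "cring \<C>" by (rule cring_from_type_algebra)
  show "abelian_group (mult_functions G n)"
  proof (rule abelian_groupI)
    fix F assume F: "F \<in> carrier (mult_functions G n)"
    show "\<exists>H\<in>carrier (mult_functions G n). H \<oplus>\<^bsub>mult_functions G n\<^esub> F = \<zero>\<^bsub>mult_functions G n\<^esub>"
      by (rule bexI[of _ "\<lambda>g\<in>nlists n (carrier G). - F g"])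
        (auto simp: mult_functions_sel intro!: ext)
  qed (auto simp: mult_functions_sel fun_eq_iff PiE_def extensional_def)
qed (auto simp: mult_functions_sel complex_field_sel fun_eq_iff PiE_def extensional_def algebra_simps)

text \<open>Addition is pointwise, so induction on the index set applies. This turns the coboundary
  into an alternating sum of complex numbers at each tuple.\<close>

lemma finsum_mult_functions:
  assumes "finite A" "\<And>i. i \<in> A \<Longrightarrow> f i \<in> carrier (mult_functions G n)"
  shows "(\<Oplus>\<^bsub>mult_functions G n\<^esub> i\<in>A. f i) = (\<lambda>g\<in>nlists n (carrier G). \<Sum>i\<in>A. f i g)"
proof -
  interpret module \<C> "mult_functions G n" by (rule module_mult_functions)
  show ?thesis
    using assms
  proof (induction A)
    case empty
    then show ?case by (simp add: M.finsum_empty mult_functions_sel)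
  next
    case (insert a A)
    then have "(\<Oplus>\<^bsub>mult_functions G n\<^esub> i\<in>insert a A. f i) =
        f a \<oplus>\<^bsub>mult_functions G n\<^esub> (\<Oplus>\<^bsub>mult_functions G n\<^esub> i\<in>A. f i)"
      by (intro M.finsum_insert) auto
    with insert show ?case by (auto simp: mult_functions_sel)
  qed
qed

text \<open>The common shape of all operators, with \<open>p\<close> the map of tuples and
  \<open>w\<close> the weight. The operations of the source are given by their formulas only on
  tuples over \<open>G\<close>, hence the condition that \<open>p\<close> lands there.\<close>

lemma pullback_linear:
  assumes "\<And>g. g \<in> nlists m (carrier G) \<Longrightarrow> p g \<in> nlists n (carrier G)"
  shows "(\<lambda>F. \<lambda>g\<in>nlists m (carrier G). F (p g) * w g)
    \<in> linear_maps \<C> (mult_functions G n) (mult_functions G m)"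
  using assms
  by (auto simp: linear_maps_def mult_functions_sel complex_field_sel algebra_simps intro!: ext)

section \<open>Characters and products of tuples\<close>

locale group_with_character = group G for G :: "('g, 'z) monoid_scheme" (structure) +
  fixes \<sigma> :: "'g \<Rightarrow> complex"
  assumes character: "\<sigma> \<in> hom G (mult_of \<C>)"
begin

lemma character_mult: "a \<in> carrier G \<Longrightarrow> b \<in> carrier G \<Longrightarrow> \<sigma> (a \<otimes> b) = \<sigma> a * \<sigma> b"
  using character by (simp add: hom_def complex_field_sel)

lemma character_nonzero: "a \<in> carrier G \<Longrightarrow> \<sigma> a \<noteq> 0"
  using character by (auto simp: hom_def complex_field_sel)

text \<open>The value at \<open>\<one>\<close> is a nonzero idempotent.\<close>

lemma character_one: "\<sigma> \<one> = 1"
  using character_mult[of \<one> \<one>] character_nonzero[of \<one>] by simp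

lemma character_inv_mult: "a \<in> carrier G \<Longrightarrow> \<sigma> (inv a) * \<sigma> a = 1"
  using character_mult[of "inv a" a] character_one by simp

abbreviation list_prod :: "'g list \<Rightarrow> 'g"
  where "list_prod g \<equiv> foldr (\<otimes>) g \<one>"

lemma list_prod_closed: "set g \<subseteq> carrier G \<Longrightarrow> list_prod g \<in> carrier G"
  by (induction g) auto

lemma list_prod_append:
  "set g \<subseteq> carrier G \<Longrightarrow> set h \<subseteq> carrier G \<Longrightarrow> list_prod (g @ h) = list_prod g \<otimes> list_prod h"
  by (induction g) (auto simp: list_prod_closed m_assoc)

lemma character_list_prod: "set g \<subseteq> carrier G \<Longrightarrow> \<sigma> (list_prod g) = prod_list (map \<sigma> g)"
  by (induction g) (auto simp: character_one character_mult list_prod_closed)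

section \<open>Maps of tuples given by coordinates\<close>

text \<open>
  The cases \<open>i = 0\<close> and \<open>i = n + 1\<close>, which delete the first and the last entry, are included.
\<close>

definition face :: "nat \<Rightarrow> nat \<Rightarrow> 'g list \<Rightarrow> 'g list"
  where "face n i g = map (\<lambda>k. if k + 1 < i then g ! k
    else if k + 1 = i then g ! k \<otimes> g ! (k + 1) else g ! (k + 1)) [0..<n]"

text \<open>The entrywise form reduces identities between maps of tuples to case distinctions on
  indices.\<close>

definition degeneracy :: "nat \<Rightarrow> nat \<Rightarrow> 'g list \<Rightarrow> 'g list"
  where "degeneracy n j g =
    map (\<lambda>k. if k < j then g ! k else if k = j then \<one> else g ! (k - 1)) [0..<Suc n]"

text \<open>With \<open>g\<^sub>0\<close> the inverse of the product,
  \<open>(g\<^sub>1, ..., g\<^sub>n)\<close> goes to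
  \<open>(g\<^sub>0, ..., g\<^sub>n\<^sub>-\<^sub>1)\<close>: a rotation of the full tuple
  \<open>(g\<^sub>0, ..., g\<^sub>n)\<close>, seen without its first entry.\<close>

definition rotation :: "nat \<Rightarrow> 'g list \<Rightarrow> 'g list"
  where "rotation n g = map (\<lambda>k. if k = 0 then inv (list_prod g) else g ! (k - 1)) [0..<n]"

lemma nth_closed: "g \<in> nlists n (carrier G) \<Longrightarrow> k < n \<Longrightarrow> g ! k \<in> carrier G"
  by (rule nlistsE_nth_in)

lemma list_prod_nlists: "g \<in> nlists n (carrier G) \<Longrightarrow> list_prod g \<in> carrier G"
  by (simp add: list_prod_closed)

lemma length_maps [simp]:
  "length (face n i g) = n" "length (degeneracy n j g) = Suc n" "length (rotation n g) = n"
  by (simp_all add: face_def degeneracy_def rotation_def)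

lemma nth_face:
  "k < n \<Longrightarrow> face n i g ! k = (if k + 1 < i then g ! k
    else if k + 1 = i then g ! k \<otimes> g ! (k + 1) else g ! (k + 1))"
  by (simp add: face_def)

lemma nth_degeneracy:
  "k \<le> n \<Longrightarrow> degeneracy n j g ! k = (if k < j then g ! k else if k = j then \<one> else g ! (k - 1))"
  unfolding degeneracy_def by (subst nth_map) (simp_all del: upt_Suc)

lemma nth_rotation:
  "k < n \<Longrightarrow> rotation n g ! k = (if k = 0 then inv (list_prod g) else g ! (k - 1))"
  by (simp add: rotation_def)

lemma face_closed:
  assumes "g \<in> nlists (Suc n) (carrier G)"
  shows "face n i g \<in> nlists n (carrier G)"
  by (rule nlistsI) (auto simp: face_def intro!: m_closed nth_closed[OF assms])

lemma degeneracy_closed: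
  assumes "g \<in> nlists n (carrier G)" "j \<le> n"
  shows "degeneracy n j g \<in> nlists (Suc n) (carrier G)"
  using assms(2)
  by (intro nlistsI) (auto simp: degeneracy_def simp del: upt_Suc intro!: nth_closed[OF assms(1)])

lemma rotation_closed:
  assumes "g \<in> nlists n (carrier G)"
  shows "rotation n g \<in> nlists n (carrier G)"
  by (rule nlistsI) (auto simp: rotation_def intro!: nth_closed[OF assms] list_prod_nlists[OF assms])

lemma face_append:
  assumes "set g \<subseteq> carrier G" "length g = n + 1" "1 \<le> i" "i \<le> n"
  shows "face n i g = take (i - 1) g @ [g ! (i - 1) \<otimes> g ! i] @ drop (i + 1) g"
  using assms by (intro nth_ext[of _ n]) (auto simp: nth_face nth_append nth_Cons')

lemma degeneracy_append:
  assumes "length g = n" "j \<le> n"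
  shows "degeneracy n j g = take j g @ [\<one>] @ drop j g"
  using assms by (intro nth_ext[of _ "Suc n"]) (auto simp: nth_degeneracy nth_append nth_Cons')

section \<open>The operators as weighted pullbacks\<close>

lemma coface_eq:
  assumes "i \<le> Suc n"
  shows "coface G \<sigma> n i = (\<lambda>F. \<lambda>g\<in>nlists (Suc n) (carrier G).
    F (face n i g) * (if i = Suc n then \<sigma> (g ! n) else 1))"
proof (rule ext, unfold coface_def Suc_eq_plus1, rule restrict_ext)
  fix F :: "'g list \<Rightarrow> complex" and g
  assume g: "g \<in> nlists (n + 1) (carrier G)"
  \<comment> \<open>The outer indices turn \<open>face\<close> into the two deletions; only the
    deletion of the last entry carries a weight, namely \<open>\<sigma>\<close> of that
    entry.\<close>
  have "face n 0 g = tl g"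
    using g by (intro nth_ext[of _ n]) (auto simp: nth_face nth_tl)
  moreover have "face n (n + 1) g = butlast g"
    using g by (intro nth_ext[of _ n]) (auto simp: nth_face nth_butlast)
  moreover have "last g = g ! n"
    using nlistsE_length[OF g] by (subst last_conv_nth) auto
  ultimately show "(if i = 0 then F (tl g)
       else if i \<le> n then F (take (i - 1) g @ [g ! (i - 1) \<otimes> g ! i] @ drop (i + 1) g)
       else F (butlast g) * \<sigma> (last g)) = F (face n i g) * (if i = n + 1 then \<sigma> (g ! n) else 1)"
    using assms g face_append[of g n i] by (cases "i = n + 1") auto
qed

lemma codegeneracy_eq:
  assumes "j \<le> n"
  shows "codegeneracy G n j = (\<lambda>F. \<lambda>g\<in>nlists n (carrier G). F (degeneracy n j g) * 1)"
proof (rule ext, unfold codegeneracy_def, rule restrict_ext)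
  fix F :: "'g list \<Rightarrow> complex" and g
  assume g: "g \<in> nlists n (carrier G)"
  then show "F (take j g @ [\<one>] @ drop j g) = F (degeneracy n j g) * 1"
    using assms by (simp add: degeneracy_append)
qed

lemma rotation_eq:
  assumes "length g = n" "0 < n"
  shows "rotation n g = inv (list_prod g) # butlast g"
  using assms by (intro nth_ext[of _ n]) (auto simp: nth_rotation nth_Cons' nth_butlast)

text \<open>In degree 0 the operator is the identity, with no restriction to tuples; it agrees with
  the restricted formula because elements of the carrier are extensional.\<close>

lemma cyclicity_eq:
  assumes "F \<in> carrier (mult_functions G n)"
  shows "cyclicity G \<sigma> n F = (\<lambda>g\<in>nlists n (carrier G).
    F (rotation n g) * (if n = 0 then 1 else \<sigma> (g ! (n - 1))))"
proof (cases "n = 0")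
  case True
  with assms show ?thesis
    by (auto simp: cyclicity_def mult_functions_sel rotation_def PiE_def extensional_def)
next
  case False
  then show ?thesis
    unfolding cyclicity_def
    by (auto simp: rotation_eq last_conv_nth simp flip: length_greater_0_conv intro!: restrict_ext)
qed

lemma coface_linear:
  "i \<le> Suc n \<Longrightarrow> coface G \<sigma> n i \<in> linear_maps \<C> (mult_functions G n) (mult_functions G (Suc n))"
  by (simp add: coface_eq face_closed pullback_linear)

lemma codegeneracy_linear:
  "j \<le> n \<Longrightarrow> codegeneracy G n j \<in> linear_maps \<C> (mult_functions G (Suc n)) (mult_functions G n)"
  unfolding codegeneracy_eq by (rule pullback_linear) (rule degeneracy_closed)

lemma cyclicity_linear:
  "cyclicity G \<sigma> n \<in> linear_maps \<C> (mult_functions G n) (mult_functions G n)"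
  by (rule linear_maps_cong[OF pullback_linear cyclicity_eq module_mult_functions])
    (rule rotation_closed)

lemma coface_closed:
  "i \<le> Suc n \<Longrightarrow> F \<in> carrier (mult_functions G n)
    \<Longrightarrow> coface G \<sigma> n i F \<in> carrier (mult_functions G (Suc n))"
  by (rule linear_maps_closed[OF coface_linear])

lemma codegeneracy_closed:
  "j \<le> n \<Longrightarrow> F \<in> carrier (mult_functions G (Suc n))
    \<Longrightarrow> codegeneracy G n j F \<in> carrier (mult_functions G n)"
  by (rule linear_maps_closed[OF codegeneracy_linear])

lemma cyclicity_closed:
  "F \<in> carrier (mult_functions G n) \<Longrightarrow> cyclicity G \<sigma> n F \<in> carrier (mult_functions G n)"
  by (rule linear_maps_closed[OF cyclicity_linear])

lemma funpow_cyclicity_closed: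
  "F \<in> carrier (mult_functions G n) \<Longrightarrow> (cyclicity G \<sigma> n ^^ k) F \<in> carrier (mult_functions G n)"
  by (induction k) (simp_all add: cyclicity_closed)

lemma coface_apply:
  assumes "i \<le> Suc n" "g \<in> nlists (Suc n) (carrier G)"
  shows "coface G \<sigma> n i F g = F (face n i g) * (if i = Suc n then \<sigma> (g ! n) else 1)"
  using assms by (simp add: coface_eq)

lemma codegeneracy_apply:
  assumes "j \<le> n" "g \<in> nlists n (carrier G)"
  shows "codegeneracy G n j F g = F (degeneracy n j g)"
  using assms by (simp add: codegeneracy_eq)

lemma cyclicity_apply:
  assumes "F \<in> carrier (mult_functions G n)" "g \<in> nlists n (carrier G)"
  shows "cyclicity G \<sigma> n F g = F (rotation n g) * (if n = 0 then 1 else \<sigma> (g ! (n - 1)))"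
  using assms by (simp add: cyclicity_eq)

section \<open>Cosimplicial identities\<close>

lemma face_face:
  assumes "i < j" "j \<le> n + 2" "g \<in> nlists (n + 2) (carrier G)"
  shows "face n i (face (Suc n) j g) = face n (j - 1) (face (Suc n) i g)"
  using assms
  \<comment> \<open>Associativity enters for \<open>j = i + 1\<close> with \<open>i \<ge> 1\<close>,
    where three neighbouring entries are merged in two ways.\<close>
  by (intro nth_ext[of _ n]) (auto simp: nth_face intro!: m_assoc[symmetric] nth_closed)

lemma degeneracy_degeneracy:
  assumes "i \<le> j" "j \<le> n"
  shows "degeneracy (Suc n) i (degeneracy n j g) = degeneracy (Suc n) (j + 1) (degeneracy n i g)"
  using assms
  by (intro nth_ext[of _ "n + 2"]) (auto simp: nth_degeneracy)

lemma face_degeneracy_less: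
  assumes "i < j" "j \<le> Suc n" "g \<in> nlists (Suc n) (carrier G)"
  shows "face (Suc n) i (degeneracy (Suc n) j g) = degeneracy n (j - 1) (face n i g)"
  using assms
  by (intro nth_ext[of _ "Suc n"]) (auto simp: nth_degeneracy nth_face intro!: nth_closed)

lemma face_degeneracy_id:
  assumes "i = j \<or> i = j + 1" "j \<le> n" "g \<in> nlists n (carrier G)"
  shows "face n i (degeneracy n j g) = g"
  using assms
  by (intro nth_ext[of _ "n"]) (auto simp: nth_degeneracy nth_face intro!: r_one l_one nth_closed)

lemma face_degeneracy_greater:
  assumes "j + 1 < i" "i \<le> n + 2" "g \<in> nlists (Suc n) (carrier G)"
  shows "face (Suc n) i (degeneracy (Suc n) j g) = degeneracy n j (face n (i - 1) g)"
  using assms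
  by (intro nth_ext[of _ "Suc n"]) (auto simp: nth_degeneracy nth_face)

lemma coface_coface:
  assumes ij: "i < j" "j \<le> n + 2" and x: "x \<in> carrier (mult_functions G n)"
  shows "coface G \<sigma> (Suc n) j (coface G \<sigma> n i x) = coface G \<sigma> (Suc n) i (coface G \<sigma> n (j - 1) x)"
proof (rule mult_functions_eqI[of _ G "n + 2"])
  fix g assume g: "g \<in> nlists (n + 2) (carrier G)"
  \<comment> \<open>Needed for \<open>i = n + 1\<close>, \<open>j = n + 2\<close>: one side removes
    the last two entries one after the other, the other side merges them and then removes the
    product.\<close>
  have "\<sigma> (g ! n \<otimes> g ! Suc n) = \<sigma> (g ! n) * \<sigma> (g ! Suc n)"
    by (intro character_mult nth_closed[OF g]) auto
  then show "coface G \<sigma> (Suc n) j (coface G \<sigma> n i x) g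
      = coface G \<sigma> (Suc n) i (coface G \<sigma> n (j - 1) x) g"
    using ij g face_face[OF ij g]
    by (auto simp: coface_apply face_closed nth_face)
qed (use ij x in \<open>auto simp: coface_closed\<close>)

lemma codegeneracy_codegeneracy:
  assumes ij: "i \<le> j" "j \<le> n" and x: "x \<in> carrier (mult_functions G (n + 2))"
  shows "codegeneracy G n j (codegeneracy G (Suc n) i x)
    = codegeneracy G n i (codegeneracy G (Suc n) (j + 1) x)"
proof (rule mult_functions_eqI[of _ G n])
  fix g assume g: "g \<in> nlists n (carrier G)"
  then show "codegeneracy G n j (codegeneracy G (Suc n) i x) g
    = codegeneracy G n i (codegeneracy G (Suc n) (j + 1) x) g"
    using ij degeneracy_degeneracy[OF ij]
    by (auto simp: codegeneracy_apply degeneracy_closed)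
qed (use ij x in \<open>auto simp: codegeneracy_closed\<close>)

lemma codegeneracy_coface_less:
  assumes ij: "i < j" "j \<le> Suc n" and x: "x \<in> carrier (mult_functions G (Suc n))"
  shows "codegeneracy G (Suc n) j (coface G \<sigma> (Suc n) i x)
    = coface G \<sigma> n i (codegeneracy G n (j - 1) x)"
proof (rule mult_functions_eqI[of _ G "Suc n"])
  fix g assume g: "g \<in> nlists (Suc n) (carrier G)"
  then show "codegeneracy G (Suc n) j (coface G \<sigma> (Suc n) i x) g
    = coface G \<sigma> n i (codegeneracy G n (j - 1) x) g"
    using ij face_degeneracy_less[OF ij g]
    by (auto simp: codegeneracy_apply coface_apply degeneracy_closed face_closed)
qed (use ij x in \<open>auto simp: coface_closed codegeneracy_closed\<close>)

text \<open>For \<open>i = n + 1\<close>, which forces \<open>j = n\<close>, the weight falls on the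
  inserted \<open>\<one>\<close>, where \<open>\<sigma>\<close> is 1.\<close>

lemma codegeneracy_coface_id:
  assumes ij: "i = j \<or> i = j + 1" "j \<le> n" and x: "x \<in> carrier (mult_functions G n)"
  shows "codegeneracy G n j (coface G \<sigma> n i x) = x"
proof (rule mult_functions_eqI[of _ G n])
  fix g assume g: "g \<in> nlists n (carrier G)"
  then show "codegeneracy G n j (coface G \<sigma> n i x) g = x g"
    using ij face_degeneracy_id[OF ij g]
    by (auto simp: codegeneracy_apply coface_apply degeneracy_closed nth_degeneracy character_one)
qed (use ij x in \<open>auto simp: coface_closed codegeneracy_closed\<close>)

lemma codegeneracy_coface_greater:
  assumes ij: "j + 1 < i" "i \<le> n + 2" and x: "x \<in> carrier (mult_functions G (Suc n))"
  shows "codegeneracy G (Suc n) j (coface G \<sigma> (Suc n) i x)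
    = coface G \<sigma> n (i - 1) (codegeneracy G n j x)"
proof (rule mult_functions_eqI[of _ G "Suc n"])
  fix g assume g: "g \<in> nlists (Suc n) (carrier G)"
  then show "codegeneracy G (Suc n) j (coface G \<sigma> (Suc n) i x) g
    = coface G \<sigma> n (i - 1) (codegeneracy G n j x) g"
    using ij face_degeneracy_greater[OF ij g]
    by (auto simp: codegeneracy_apply coface_apply degeneracy_closed face_closed nth_degeneracy)
qed (use ij x in \<open>auto simp: coface_closed codegeneracy_closed\<close>)

lemma cosimplicial: "cosimplicial_module \<C> (mult_functions G) (coface G \<sigma>) (codegeneracy G)"
  by (intro cosimplicial_module.intro module_mult_functions coface_linear codegeneracy_linear
      coface_coface codegeneracy_codegeneracy codegeneracy_coface_less codegeneracy_coface_id
      codegeneracy_coface_greater)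

section \<open>Compatibility of the cyclicity operators with cofaces and codegeneracies\<close>

lemma list_prod_face:
  assumes g: "g \<in> nlists (Suc n) (carrier G)" and i: "1 \<le> i" "i \<le> n"
  shows "list_prod (face n i g) = list_prod g"
proof -
  let ?a = "g ! (i - 1)" and ?b = "g ! i" and ?u = "take (i - 1) g" and ?v = "drop (i + 1) g"
  have len: "length g = n + 1" and sub: "set g \<subseteq> carrier G"
    using g by auto
  have "g = ?u @ ?a # drop i g"
    using i len id_take_nth_drop[of "i - 1" g] by simp
  moreover have "drop i g = ?b # ?v"
    using i len Cons_nth_drop_Suc[of i g] by simp
  ultimately have "g = ?u @ ?a # ?b # ?v" by simp
  then have "list_prod g = list_prod (?u @ ?a # ?b # ?v)" by (rule arg_cong)
  also have "\<dots> = list_prod (?u @ [?a \<otimes> ?b] @ ?v)"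
  proof -
    have "?a \<in> carrier G" "?b \<in> carrier G"
      using i by (auto intro!: nth_closed[OF g])
    moreover have "set ?v \<subseteq> carrier G"
      using sub set_drop_subset by (rule order_trans[rotated])
    ultimately show ?thesis
      by (simp add: m_assoc list_prod_closed)
  qed
  finally show ?thesis
    by (simp only: face_append[OF sub len i])
qed

lemma list_prod_face_0:
  assumes "g \<in> nlists (Suc n) (carrier G)"
  shows "list_prod g = g ! 0 \<otimes> list_prod (face n 0 g)"
proof -
  have "face n 0 g = tl g"
    using assms by (intro nth_ext[of _ n]) (auto simp: nth_face nth_tl)
  with assms show ?thesis by (auto simp: in_nlists_Suc_iff)
qed

lemma face_rotation:
  assumes "1 \<le> p" "p \<le> Suc n" "g \<in> nlists (Suc n) (carrier G)"
  shows "face n p (rotation (Suc n) g) = rotation n (face n (p - 1) g)"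
proof (rule nth_ext[of _ n])
  fix k assume k: "k < n"
  \<comment> \<open>The case \<open>p = 1\<close> merges the new front entry with the first factor:
    the inverse of \<open>a \<otimes> b\<close>, times \<open>a\<close>, is the inverse of
    \<open>b\<close>.\<close>
  have "inv (list_prod g) \<otimes> g ! 0 = inv (list_prod (face n 0 g))"
  proof -
    have "list_prod (face n 0 g) \<in> carrier G" "g ! 0 \<in> carrier G"
      using assms(3) by (auto intro!: nth_closed list_prod_nlists face_closed)
    then show ?thesis
      by (simp add: list_prod_face_0[OF assms(3)] inv_mult_group m_assoc)
  qed
  \<comment> \<open>For \<open>p > 1\<close> the face on the right is an inner one, so it only
    merges factors and the front entry is unchanged.\<close>
  moreover have "list_prod (face n (p - 1) g) = list_prod g" if "p \<noteq> 1"
    using assms that by (intro list_prod_face) auto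
  ultimately show "face n p (rotation (Suc n) g) ! k = rotation n (face n (p - 1) g) ! k"
    using k assms(1,2) by (auto simp: nth_face nth_rotation)
qed auto

lemma list_prod_degeneracy:
  assumes "g \<in> nlists n (carrier G)" "j \<le> n"
  shows "list_prod (degeneracy n j g) = list_prod g"
proof -
  have "degeneracy n j g = take j g @ [\<one>] @ drop j g"
    using assms by (simp add: degeneracy_append)
  moreover have "set (take j g) \<subseteq> carrier G" "set (drop j g) \<subseteq> carrier G"
    using assms(1) set_take_subset set_drop_subset nlistsE_set by (metis order_trans)+
  ultimately show ?thesis
    using list_prod_append[of "take j g" "drop j g"]
    by (simp add: list_prod_append list_prod_closed del: foldr_append)
qed

lemma cyclicity_coface:
  assumes p: "1 \<le> p" "p \<le> Suc n" and x: "x \<in> carrier (mult_functions G n)"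
  shows "cyclicity G \<sigma> (Suc n) (coface G \<sigma> n p x) = coface G \<sigma> n (p - 1) (cyclicity G \<sigma> n x)"
proof (rule mult_functions_eqI[of _ G "Suc n"])
  fix g assume g: "g \<in> nlists (Suc n) (carrier G)"
  \<comment> \<open>This settles \<open>n = 0\<close>, \<open>p = 1\<close>: the coface weighs the
    inverted entry and the rotation weighs the entry itself, while the right side has weight
    1.\<close>
  have "\<sigma> (inv (g ! 0)) * \<sigma> (g ! 0) = 1"
    using g by (intro character_inv_mult nth_closed) auto
  \<comment> \<open>For \<open>n \<ge> 1\<close> and \<open>p = n + 1\<close>, the left side
    collects the weights of the last two entries separately, the right side that of their
    product.\<close>
  moreover have "\<sigma> (g ! (n - 1) \<otimes> g ! n) = \<sigma> (g ! (n - 1)) * \<sigma> (g ! n)"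
    using g by (intro character_mult nth_closed) auto
  moreover have "list_prod g = g ! 0" if "n = 0"
    using g that list_prod_face_0[OF g] nth_closed[OF g, of 0] by (simp add: face_def)
  ultimately show "cyclicity G \<sigma> (Suc n) (coface G \<sigma> n p x) g
      = coface G \<sigma> n (p - 1) (cyclicity G \<sigma> n x) g"
    using p face_rotation[OF p g] g x rotation_closed[OF g]
    by (auto simp: cyclicity_apply coface_closed coface_apply face_closed
        nth_rotation nth_face)
qed (use p x in \<open>auto simp: coface_closed cyclicity_closed\<close>)

lemma cyclicity_coface_zero:
  assumes x: "x \<in> carrier (mult_functions G n)"
  shows "cyclicity G \<sigma> (Suc n) (coface G \<sigma> n 0 x) = coface G \<sigma> n (Suc n) x"
proof (rule mult_functions_eqI[of _ G "Suc n"])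
  fix g assume g: "g \<in> nlists (Suc n) (carrier G)"
  \<comment> \<open>The face deletes exactly the entry that the rotation has put in front.\<close>
  have "face n 0 (rotation (Suc n) g) = face n (Suc n) g"
    by (rule nth_ext[of _ n]) (auto simp: nth_face nth_rotation)
  then show "cyclicity G \<sigma> (Suc n) (coface G \<sigma> n 0 x) g = coface G \<sigma> n (Suc n) x g"
    using g x rotation_closed[OF g]
    by (simp add: cyclicity_apply coface_closed coface_apply)
qed (use x in \<open>auto simp: coface_closed cyclicity_closed\<close>)

lemma cyclicity_codegeneracy:
  assumes p: "1 \<le> p" "p \<le> n" and x: "x \<in> carrier (mult_functions G (Suc n))"
  shows "cyclicity G \<sigma> n (codegeneracy G n p x) = codegeneracy G n (p - 1) (cyclicity G \<sigma> (Suc n) x)"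
proof (rule mult_functions_eqI[of _ G n])
  fix g assume g: "g \<in> nlists n (carrier G)"
  \<comment> \<open>The inserted unit leaves the front entry of the rotation unchanged, and the
    rotation moves it from position \<open>p - 1\<close> to \<open>p\<close>.\<close>
  have "list_prod (degeneracy n (p - 1) g) = list_prod g"
    using p by (intro list_prod_degeneracy[OF g]) auto
  then have "degeneracy n p (rotation n g) = rotation (Suc n) (degeneracy n (p - 1) g)"
    using p by (intro nth_ext[of _ "Suc n"]) (auto simp: nth_degeneracy nth_rotation)
  then show "cyclicity G \<sigma> n (codegeneracy G n p x) g
      = codegeneracy G n (p - 1) (cyclicity G \<sigma> (Suc n) x) g"
    using p g x rotation_closed[OF g]
    by (auto simp: cyclicity_apply codegeneracy_closed codegeneracy_apply degeneracy_closed
        nth_degeneracy)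
qed (use p x in \<open>auto simp: codegeneracy_closed cyclicity_closed\<close>)

lemma cyclicity_codegeneracy_zero:
  assumes x: "x \<in> carrier (mult_functions G (Suc n))"
  shows "cyclicity G \<sigma> n (codegeneracy G n 0 x)
    = codegeneracy G n n ((cyclicity G \<sigma> (Suc n) ^^ 2) x)"
proof (rule mult_functions_eqI[of _ G n])
  fix g assume g: "g \<in> nlists n (carrier G)"
  let ?h = "degeneracy n n g" and ?r = "rotation (Suc n)"
  have h: "?h \<in> nlists (Suc n) (carrier G)"
    using g by (rule degeneracy_closed) simp
  have ph: "list_prod ?h = list_prod g"
    using g by (rule list_prod_degeneracy) simp
  \<comment> \<open>One rotation of \<open>g\<close> with \<open>\<one>\<close> appended gives the
    full tuple with product \<open>\<one>\<close>, so the second rotation brings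
    \<open>\<one>\<close> to the front, where \<open>degeneracy n 0\<close> inserts it.\<close>
  have pr: "list_prod (?r ?h) = \<one>"
  proof -
    have "butlast ?h = g"
      using g by (intro nth_ext[of _ n]) (auto simp: nth_butlast nth_degeneracy)
    then have "?r ?h = inv (list_prod g) # g"
      by (subst rotation_eq) (simp_all add: ph)
    then show ?thesis
      using list_prod_nlists[OF g] by simp
  qed
  have "degeneracy n 0 (rotation n g) = ?r (?r ?h)"
    by (rule nth_ext[of _ "Suc n"]) (auto simp: nth_rotation nth_degeneracy pr ph)
  \<comment> \<open>This entry gives the weight of the second rotation; the first one weighs the
    appended \<open>\<one>\<close>. For \<open>n = 0\<close> the entry is \<open>\<one>\<close>,
    matching the trivial weight in degree 0.\<close>
  moreover have "?r ?h ! n = (if n = 0 then \<one> else g ! (n - 1))"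
    using g ph by (cases "n = 0") (auto simp: nth_rotation nth_degeneracy)
  ultimately show "cyclicity G \<sigma> n (codegeneracy G n 0 x) g
      = codegeneracy G n n ((cyclicity G \<sigma> (Suc n) ^^ 2) x) g"
    using g x h rotation_closed[OF g] rotation_closed[OF h]
    by (auto simp: numeral_2_eq_2 cyclicity_apply cyclicity_closed codegeneracy_closed
        codegeneracy_apply nth_degeneracy character_one)
qed (use x in \<open>auto simp: numeral_2_eq_2 codegeneracy_closed cyclicity_closed\<close>)

section \<open>The order of the cyclicity operators\<close>

text \<open>
  Writing an \<open>n\<close>-tuple as the tail of a tuple with product \<open>\<one>\<close> turns the cyclicity operator into a
  plain rotation, without inverses.
\<close>

lemma cyclicity_cycle:
  assumes F: "F \<in> carrier (mult_functions G n)"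
    and h: "h \<in> nlists (Suc n) (carrier G)" "list_prod h = \<one>"
  shows "cyclicity G \<sigma> n F (tl h) = F (butlast h) * \<sigma> (last h)"
proof (cases "n = 0")
  case True
  with h(1) obtain a where a: "h = [a]" "a \<in> carrier G"
    by (auto simp: in_nlists_Suc_iff)
  with h(2) have "a = \<one>" by simp
  with True a show ?thesis by (simp add: cyclicity_def character_one)
next
  case False
  obtain a g where ag: "h = a # g" "a \<in> carrier G" "g \<in> nlists n (carrier G)"
    using h(1) unfolding in_nlists_Suc_iff by blast
  then have "inv (list_prod g) = a"
    using h(2) by (intro inv_equality list_prod_nlists) simp_all
  moreover have "g \<noteq> []"
    using False ag(3) nlistsE_length by fastforce
  ultimately show ?thesis
    using False ag by (simp add: cyclicity_def)
qed

text \<open>Each application moves the last entry of \<open>ys\<close> to the front of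
  \<open>xs\<close> and contributes its character value. As \<open>xs\<close> grows in this way, it
  stays arbitrary in the induction.\<close>

lemma funpow_cyclicity_cycle:
  assumes "F \<in> carrier (mult_functions G n)" "xs @ ys \<in> nlists (Suc n) (carrier G)"
    "list_prod (xs @ ys) = \<one>"
  shows "(cyclicity G \<sigma> n ^^ length ys) F (tl (xs @ ys)) = F (tl (ys @ xs)) * prod_list (map \<sigma> ys)"
  using assms
proof (induction ys arbitrary: xs rule: rev_induct)
  case Nil
  then show ?case by simp
next
  case (snoc y ys)
  have sets: "set xs \<subseteq> carrier G" "set ys \<subseteq> carrier G" "y \<in> carrier G"
    using nlistsE_set[OF snoc.prems(2)] by auto
  let ?c = "cyclicity G \<sigma> n"
  have "list_prod (xs @ ys) \<otimes> y = \<one>"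
    using snoc.prems(3) sets list_prod_append[of "xs @ ys" "[y]"] by simp
  \<comment> \<open>In a group a one-sided inverse is two-sided, so the rotated tuple again has
    product \<open>\<one>\<close>.\<close>
  then have "y \<otimes> list_prod (xs @ ys) = \<one>"
    using sets by (intro inv_comm[of _ y] list_prod_closed) simp_all
  then have "list_prod ((y # xs) @ ys) = \<one>"
    by simp
  moreover have "(y # xs) @ ys \<in> nlists (Suc n) (carrier G)"
    using sets nlistsE_length[OF snoc.prems(2)] by (intro nlistsI) auto
  ultimately have "(?c ^^ length ys) F (tl ((y # xs) @ ys))
      = F (tl (ys @ y # xs)) * prod_list (map \<sigma> ys)"
    by (intro snoc.IH[OF snoc.prems(1)])
  moreover have "(?c ^^ Suc (length ys)) F (tl (xs @ ys @ [y]))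
      = (?c ^^ length ys) F (butlast (xs @ ys @ [y])) * \<sigma> (last (xs @ ys @ [y]))"
    unfolding funpow.simps comp_apply
    using funpow_cyclicity_closed[OF snoc.prems(1)] snoc.prems(2,3) by (rule cyclicity_cycle)
  moreover have "butlast (xs @ ys @ [y]) = xs @ ys"
    by (simp flip: append_assoc)
  ultimately show ?case
    by simp
qed

lemma cyclicity_power:
  assumes x: "x \<in> carrier (mult_functions G n)"
  shows "(cyclicity G \<sigma> n ^^ (Suc n)) x = x"
proof (rule mult_functions_eqI[of _ G n])
  show "(cyclicity G \<sigma> n ^^ (Suc n)) x \<in> carrier (mult_functions G n)"
    by (rule funpow_cyclicity_closed[OF x])
  fix g assume g: "g \<in> nlists n (carrier G)"
  \<comment> \<open>The full tuple of length \<open>n + 1\<close>. Taking \<open>xs\<close> empty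
    and \<open>ys\<close> equal to it makes \<open>n + 1\<close> applications a complete
    turn.\<close>
  let ?h = "inv (list_prod g) # g"
  have h: "?h \<in> nlists (Suc n) (carrier G)"
    using g by (auto simp: list_prod_nlists)
  have ph: "list_prod ?h = \<one>"
    using list_prod_nlists[OF g] by simp
  have "prod_list (map \<sigma> ?h) = 1"
    using character_list_prod[OF nlistsE_set[OF h]] ph character_one by simp
  then show "(cyclicity G \<sigma> n ^^ (Suc n)) x g = x g"
    using funpow_cyclicity_cycle[of x n "[]" ?h] g h ph x by simp
qed (rule x)

lemma cocyclic:
  "cocyclic_module \<C> (mult_functions G) (coface G \<sigma>) (codegeneracy G) (cyclicity G \<sigma>)"
  by (rule cocyclic_module.intro[OF cosimplicial])
    (intro cocyclic_module_axioms.intro; simp add: cyclicity_linear cyclicity_coface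
      cyclicity_coface_zero cyclicity_codegeneracy cyclicity_codegeneracy_zero cyclicity_power
      del: funpow.simps)

section \<open>The coboundary on cyclic cochains\<close>

lemma coboundary_eq:
  assumes "x \<in> carrier (mult_functions G n)"
  shows "coboundary G \<sigma> n x = (\<lambda>g\<in>nlists (Suc n) (carrier G).
    \<Sum>i\<in>{0..Suc n}. (-1) ^ i * coface G \<sigma> n i x g)"
proof -
  interpret module \<C> "mult_functions G (Suc n)" by (rule module_mult_functions)
  have "coboundary G \<sigma> n x = (\<lambda>g\<in>nlists (Suc n) (carrier G).
    \<Sum>i\<in>{0..Suc n}. ((-1) ^ i \<odot>\<^bsub>mult_functions G (Suc n)\<^esub> coface G \<sigma> n i x) g)"
    unfolding coboundary_def Suc_eq_plus1[symmetric]
    using assms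
    by (intro finsum_mult_functions smult_closed coface_closed) (auto simp: complex_field_sel)
  then show ?thesis
    by (auto simp: mult_functions_sel intro!: restrict_ext)
qed

lemma coboundary_closed:
  "x \<in> carrier (mult_functions G n) \<Longrightarrow> coboundary G \<sigma> n x \<in> carrier (mult_functions G (Suc n))"
  by (simp add: coboundary_eq mult_functions_sel)

lemma cyclicity_coboundary:
  assumes x: "x \<in> carrier (mult_functions G n)"
    and cyclic: "(-1) ^ n \<odot>\<^bsub>mult_functions G n\<^esub> cyclicity G \<sigma> n x = x"
  shows "(-1) ^ (Suc n) \<odot>\<^bsub>mult_functions G (Suc n)\<^esub> cyclicity G \<sigma> (Suc n) (coboundary G \<sigma> n x)
    = coboundary G \<sigma> n x"
proof (rule mult_functions_eqI[of _ G "Suc n"])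
  fix g assume g: "g \<in> nlists (Suc n) (carrier G)"
  let ?c = "cyclicity G \<sigma> (Suc n)" and ?d = "\<lambda>i. coface G \<sigma> n i"
  have rot: "rotation (Suc n) g \<in> nlists (Suc n) (carrier G)"
    using g by (rule rotation_closed)
  \<comment> \<open>Linearity at a point: every term is evaluated at the same rotated tuple with the
    same weight \<open>\<sigma> (g ! n)\<close>.\<close>
  have sum: "?c (coboundary G \<sigma> n x) g = (\<Sum>i\<in>{0..Suc n}. (-1) ^ i * ?c (?d i x) g)"
  proof -
    have "?c (?d i x) g = ?d i x (rotation (Suc n) g) * \<sigma> (g ! n)" if "i \<le> Suc n" for i
      using cyclicity_apply[OF coface_closed[OF that x] g] by simp
    then show ?thesis
      using cyclicity_apply[OF coboundary_closed[OF x] g] rot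
      by (simp add: coboundary_eq[OF x] sum_distrib_right mult.assoc del: sum.cl_ivl_Suc)
  qed
  \<comment> \<open>The sign is its own inverse, so cyclicity of \<open>x\<close> lets
    \<open>(-1) ^ n\<close> replace the operator left over after commuting past the coface.\<close>
  have shift: "?c (?d (Suc i) x) g = (-1) ^ n * ?d i x g" if "i \<le> n" for i
  proof -
    have "cyclicity G \<sigma> n x h = (-1) ^ n * x h" if "h \<in> nlists n (carrier G)" for h
    proof -
      have "x h = (-1) ^ n * cyclicity G \<sigma> n x h"
        using that by (subst cyclic[symmetric]) (simp add: mult_functions_sel)
      then show ?thesis by simp
    qed
    then show ?thesis
      using that cyclicity_coface[of "Suc i" n x] x g face_closed[of g n i]
      by (simp add: coface_apply)
  qed
  have "?c (coboundary G \<sigma> n x) g = ?c (?d 0 x) g + (\<Sum>i\<in>{0..n}. (-1) ^ Suc i * ?c (?d (Suc i) x) g)"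
    unfolding sum by (simp add: sum.atLeast0_atMost_Suc_shift del: sum.cl_ivl_Suc)
  also have "\<dots> = ?d (Suc n) x g + (-1) ^ (Suc n) * (\<Sum>i\<in>{0..n}. (-1) ^ i * ?d i x g)"
    using cyclicity_coface_zero[OF x] unfolding sum_distrib_left
    by (intro arg_cong2[where f = "(+)"] sum.cong) (simp_all add: shift mult_ac)
  \<comment> \<open>The outer sign turns the isolated coface into the last term of the alternating
    sum and cancels against the sign before the remaining terms.\<close>
  also have "(-1) ^ (Suc n) * \<dots> = (\<Sum>i\<in>{0..Suc n}. (-1) ^ i * ?d i x g)"
    by (simp add: algebra_simps)
  finally show "((-1) ^ (Suc n) \<odot>\<^bsub>mult_functions G (Suc n)\<^esub> ?c (coboundary G \<sigma> n x)) g
      = coboundary G \<sigma> n x g"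
    using g by (simp add: mult_functions_sel coboundary_eq[OF x])
qed (use coboundary_closed[OF x] in \<open>auto simp: mult_functions_sel\<close>)

end

theorem lemma5p3:
  fixes G :: "('g, 'z) monoid_scheme" and \<sigma> :: "'g \<Rightarrow> complex"
  assumes "group G" and "\<sigma> \<in> hom G (mult_of \<C>)"
  shows "cocyclic_module \<C> (mult_functions G) (coface G \<sigma>) (codegeneracy G) (cyclicity G \<sigma>)
    \<and> (\<forall>n. \<forall>x\<in>carrier (mult_functions G n).
          (-1) ^ n \<odot>\<^bsub>mult_functions G n\<^esub> cyclicity G \<sigma> n x = x \<longrightarrow>
          coboundary G \<sigma> n x \<in> carrier (mult_functions G (n + 1)) \<and>
          (-1) ^ (n + 1) \<odot>\<^bsub>mult_functions G (n + 1)\<^esub> cyclicity G \<sigma> (n + 1) (coboundary G \<sigma> n x)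
            = coboundary G \<sigma> n x)"
proof -
  interpret group_with_character G \<sigma>
    using assms by (simp add: group_with_character_def group_with_character_axioms_def)
  show ?thesis
    using cocyclic coboundary_closed cyclicity_coboundary by (simp del: power_Suc)
qed

end
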